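(* The direct powers $\mathbb Q^\kappa$ and $\mathbb Z^\kappa$ are not reversible, for every cardinal $\kappa\geq2$.
   Context: $\mathbb Q$ and $\mathbb Z$ are the rationals and the integers with their usual (reflexive) linear orders, and the direct power $\mathbb Q^\kappa$ (resp. $\mathbb Z^\kappa$) is the set of all functions from $\kappa$ to $\mathbb Q$ (resp. $\mathbb Z$) with the coordinatewise order: $x\leq y$ iff $x_\alpha\leq y_\alpha$ for all $\alpha<\kappa$. A poset $\langle P,\leq\rangle$ is reversible iff each bijection $f:P\to P$ with $x\leq y\Rightarrow f(x)\leq f(y)$ for all $x,y\in P$ is an automorphism. *)

theory Defs
  imports Complex_Main "HOL-Library.FuncSet"
begin

unbundle cardinal_syntax

text \<open>A poset is a carrier \<open>P\<close> together with a reflexive order predicate \<open>le\<close> on it;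
  values of \<open>le\<close> and of maps outside \<open>P\<close> are irrelevant.\<close>

definition poset_on :: "'a set \<Rightarrow> ('a \<Rightarrow> 'a \<Rightarrow> bool) \<Rightarrow> bool" where
  "poset_on P le \<longleftrightarrow> reflp_on P le \<and> antisymp_on P le \<and> transp_on P le"

definition poset_automorphism :: "'a set \<Rightarrow> ('a \<Rightarrow> 'a \<Rightarrow> bool) \<Rightarrow> ('a \<Rightarrow> 'a) \<Rightarrow> bool" where
  "poset_automorphism P le f \<longleftrightarrow>
     bij_betw f P P \<and> (\<forall>x\<in>P. \<forall>y\<in>P. le x y \<longleftrightarrow> le (f x) (f y))"

text \<open>The poset axioms are deliberately not part of \<open>reversible\<close>, so that its negation is not
  satisfied by a structure that merely fails to be a poset; lemma \<open>poset_on_power\<close> below supplies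
  them for direct powers.\<close>

definition reversible :: "'a set \<Rightarrow> ('a \<Rightarrow> 'a \<Rightarrow> bool) \<Rightarrow> bool" where
  "reversible P le \<longleftrightarrow>
     (\<forall>f. bij_betw f P P \<and> monotone_on P le le f \<longrightarrow> poset_automorphism P le f)"

text \<open>A cardinal \<open>\<kappa>\<close> is a relation satisfying \<open>Card_order\<close>; its elements \<open>\<alpha> < \<kappa>\<close> are
  those of \<open>Field \<kappa>\<close>. Functions on \<open>\<kappa>\<close> are made unique by being \<open>undefined\<close> off \<open>Field \<kappa>\<close>.\<close>

definition power_carrier :: "'k rel \<Rightarrow> 'a set \<Rightarrow> ('k \<Rightarrow> 'a) set" where
  "power_carrier \<kappa> A = Field \<kappa> \<rightarrow>\<^sub>E A"

definition power_le :: "'k rel \<Rightarrow> ('a \<Rightarrow> 'a \<Rightarrow> bool) \<Rightarrow> ('k \<Rightarrow> 'a) \<Rightarrow> ('k \<Rightarrow> 'a) \<Rightarrow> bool" where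
  "power_le \<kappa> le x y \<longleftrightarrow> (\<forall>\<alpha>\<in>Field \<kappa>. le (x \<alpha>) (y \<alpha>))"

lemma poset_on_power:
  assumes "poset_on A le"
  shows "poset_on (power_carrier \<kappa> A) (power_le \<kappa> le)"
  unfolding poset_on_def
proof (intro conjI)
  show "reflp_on (power_carrier \<kappa> A) (power_le \<kappa> le)"
    using assms unfolding poset_on_def power_carrier_def power_le_def reflp_on_def
    by (blast dest: PiE_mem)
  show "antisymp_on (power_carrier \<kappa> A) (power_le \<kappa> le)"
  proof (rule antisymp_onI)
    fix x y
    assume xy: "x \<in> power_carrier \<kappa> A" "y \<in> power_carrier \<kappa> A"
      and le: "power_le \<kappa> le x y" "power_le \<kappa> le y x"
    show "x = y"
    proof (rule PiE_ext)
      show "x \<in> Field \<kappa> \<rightarrow>\<^sub>E A" "y \<in> Field \<kappa> \<rightarrow>\<^sub>E A"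
        using xy by (simp_all add: power_carrier_def)
      fix \<alpha> assume "\<alpha> \<in> Field \<kappa>"
      then show "x \<alpha> = y \<alpha>"
        using assms xy le unfolding poset_on_def power_carrier_def power_le_def
        by (meson PiE_mem antisymp_onD)
    qed
  qed
  show "transp_on (power_carrier \<kappa> A) (power_le \<kappa> le)"
    using assms unfolding poset_on_def power_carrier_def power_le_def transp_on_def
    by (meson PiE_mem)
qed

lemma poset_on_UNIV_le: "poset_on (UNIV :: 'a::order set) (\<le>)"
  by (auto simp: poset_on_def intro: reflp_onI antisymp_onI transp_onI)

end

theory Submission
  imports Defs
begin

text \<open>Fix coordinates \<open>a \<noteq> b\<close>. The shear \<open>x \<mapsto> x(b := x a + x b)\<close> is monotone and bijective, but
  its inverse subtracts \<open>x a\<close> and is not monotone: the vector with entries \<open>c > 0\<close> at \<open>a\<close>, \<open>- c\<close> at \<open>b\<close> and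
  \<open>0\<close> elsewhere is not above \<open>0\<close>, while its image is.\<close>

lemma not_reversible_power:
  fixes c :: "'a::ordered_ab_group_add"
  assumes ab: "a \<in> Field \<kappa>" "b \<in> Field \<kappa>" "a \<noteq> b" and c: "0 < c"
  shows "\<not> reversible (power_carrier \<kappa> (UNIV :: 'a set)) (power_le \<kappa> (\<le>))"
proof
  let ?P = "power_carrier \<kappa> (UNIV :: 'a set)" and ?le = "power_le \<kappa> ((\<le>) :: 'a \<Rightarrow> 'a \<Rightarrow> bool)"
  define f :: "('b \<Rightarrow> 'a) \<Rightarrow> 'b \<Rightarrow> 'a" where "f x = x(b := x a + x b)" for x
  define g :: "('b \<Rightarrow> 'a) \<Rightarrow> 'b \<Rightarrow> 'a" where "g x = x(b := x b - x a)" for x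
  assume "reversible ?P ?le"
  \<comment> \<open>Since \<open>a \<noteq> b\<close>, the shear keeps the entry at
    \<open>a\<close>, so \<open>g\<close> subtracts exactly what \<open>f\<close> added. As
    \<open>b \<in> Field \<kappa>\<close>, both maps keep the value \<open>undefined\<close> off
    \<open>Field \<kappa>\<close>.\<close>
  moreover have "bij_betw f ?P ?P"
    by (rule bij_betw_byWitness[where f' = g])
      (use ab in \<open>auto simp: f_def g_def power_carrier_def PiE_def extensional_def\<close>)
  moreover have "monotone_on ?P ?le ?le f"
    using ab by (auto simp: monotone_on_def power_le_def f_def intro: add_mono)
  ultimately have auto: "poset_automorphism ?P ?le f"
    unfolding reversible_def by blast
  \<comment> \<open>The zero vector; \<open>restrict\<close> makes it \<open>undefined\<close> off
    \<open>Field \<kappa>\<close>, as membership in the carrier demands.\<close>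
  define x where "x = restrict (\<lambda>_. 0 :: 'a) (Field \<kappa>)"
  define y where "y = x(a := c, b := - c)"
  have "x \<in> ?P" "y \<in> ?P"
    using ab by (auto simp: x_def y_def power_carrier_def PiE_def extensional_def)
  \<comment> \<open>\<open>f\<close> fixes \<open>x\<close>, and \<open>f y\<close> has
    \<open>c\<close> at \<open>a\<close> and \<open>c + (- c) = 0\<close> at
    \<open>b\<close>.\<close>
  moreover have "?le (f x) (f y)"
    using ab c by (auto simp: power_le_def f_def x_def y_def)
  ultimately have "?le x y"
    using auto unfolding poset_automorphism_def by blast
  then have "x b \<le> y b"
    using ab by (simp add: power_le_def)
  with ab c show False
    by (simp add: x_def y_def)
qed

text \<open>\<open>ctwo\<close> is the cardinality of \<open>bool\<close>, so the bound yields an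
  injection of \<open>bool\<close> into \<open>Field \<kappa>\<close>; its two values are the
  coordinates sought.\<close>

lemma ctwo_ordLeq_obtain:
  assumes "Card_order \<kappa>" and "ctwo \<le>o \<kappa>"
  obtains a b where "a \<in> Field \<kappa>" "b \<in> Field \<kappa>" "a \<noteq> b"
proof -
  have "|UNIV :: bool set| \<le>o |Field \<kappa>|"
    using assms card_of_Field_ordIso ordIso_symmetric ordLeq_ordIso_trans
    unfolding ctwo_def by blast
  then obtain h :: "bool \<Rightarrow> 'a" where "inj h" "range h \<subseteq> Field \<kappa>"
    unfolding card_of_ordLeq[symmetric] by blast
  then show thesis
    by (intro that[of "h True" "h False"]) (auto simp: inj_eq)
qed

theorem proposition7p3:
  fixes \<kappa> :: "'k rel"
  assumes "Card_order \<kappa>" and "ctwo \<le>o \<kappa>"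
  shows "\<not> reversible (power_carrier \<kappa> (UNIV :: rat set)) (power_le \<kappa> (\<le>))
       \<and> \<not> reversible (power_carrier \<kappa> (UNIV :: int set)) (power_le \<kappa> (\<le>))"
proof -
  obtain a b where ab: "a \<in> Field \<kappa>" "b \<in> Field \<kappa>" "a \<noteq> b"
    using assms by (rule ctwo_ordLeq_obtain)
  show ?thesis
    \<comment> \<open>In both groups \<open>c = 1\<close> serves as the positive element.\<close>
    by (intro conjI not_reversible_power[OF ab zero_less_one])
qed

end
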